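(* If $(bv)^{\beta}=cs$, then $[d(bv)]^{\beta}=\int cs$.
   Context: All sequences are complex sequences $x=(x_k)_{k\ge 1}$; $\omega$ is the space of all of them. $bv=\{x\in\omega:\sum_{k\ge1}|x_k-x_{k-1}|<\infty\}$ (with $x_0:=0$); $cs=\{x\in\omega:\sum_k x_k\text{ converges}\}$. For a sequence space $X$, $\int X=\{x\in\omega:(kx_k)_k\in X\}$ and $d(X)=\{x\in\omega:(k^{-1}x_k)_k\in X\}$. The $\beta$-dual of $X\subset\omega$ is $X^{\beta}=\{a\in\omega:(a_kx_k)_k\in cs\text{ for all }x\in X\}$. *)

theory Defs
  imports Complex_Main
begin

(* A sequence (x_k) with k >= 1 is a function on nat whose value at 0 is 0.
   This represents each such sequence exactly once and agrees with the
   convention x_0 := 0 used for bv. *)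

definition omega :: "(nat \<Rightarrow> complex) set" where
  "omega = {x. x 0 = 0}"

(* Series over k >= 1 are written with the shifted index Suc k, k >= 0. *)

definition bv :: "(nat \<Rightarrow> complex) set" where
  "bv = {x \<in> omega. summable (\<lambda>k. norm (x (Suc k) - x k))}"

definition cs :: "(nat \<Rightarrow> complex) set" where
  "cs = {x \<in> omega. summable (\<lambda>k. x (Suc k))}"

definition int_space :: "(nat \<Rightarrow> complex) set \<Rightarrow> (nat \<Rightarrow> complex) set" where
  "int_space X = {x \<in> omega. (\<lambda>k. of_nat k * x k) \<in> X}"

definition diff_space :: "(nat \<Rightarrow> complex) set \<Rightarrow> (nat \<Rightarrow> complex) set" where
  "diff_space X = {x \<in> omega. (\<lambda>k. inverse (of_nat k) * x k) \<in> X}"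

definition beta_dual :: "(nat \<Rightarrow> complex) set \<Rightarrow> (nat \<Rightarrow> complex) set" where
  "beta_dual X = {a \<in> omega. \<forall>x\<in>X. (\<lambda>k. a k * x k) \<in> cs}"

end

theory Submission
  imports Defs
begin

text \<open>Multiplication by k maps X bijectively onto \<open>diff_space X\<close>, and in the
  product a_k (k y_k) = (k a_k) y_k the weight k moves freely from the test sequence to a. So
  testing a against \<open>diff_space X\<close> is the same as testing (k a_k) against X. This is
  \<open>beta_dual_diff_space\<close>; for X = \<open>bv\<close> the assumed dual then turns the
  right-hand side into \<open>int_space cs\<close>.\<close>

lemma beta_dual_diff_space:
  assumes "X \<subseteq> omega"
  shows "beta_dual (diff_space X) = int_space (beta_dual X)"
proof (intro set_eqI iffI)
  fix a assume a: "a \<in> beta_dual (diff_space X)"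
  have "(\<lambda>k. of_nat k * a k * y k) \<in> cs" if "y \<in> X" for y
  proof -
    \<comment> \<open>Since \<open>inverse 0 = 0\<close>, dividing by k after multiplying by k gives
      0 at index 0, so recovering y there relies on y vanishing at 0.\<close>
    have "y 0 = 0"
      using that assms by (auto simp: omega_def)
    then have "(\<lambda>k. inverse (of_nat k) * (of_nat k * y k)) = y"
      by (auto simp: fun_eq_iff field_simps)
    then have "(\<lambda>k. of_nat k * y k) \<in> diff_space X"
      using that by (simp add: diff_space_def omega_def)
    then have "(\<lambda>k. a k * (of_nat k * y k)) \<in> cs"
      using a by (simp add: beta_dual_def)
    then show ?thesis
      by (simp add: mult_ac)
  qed
  then show "a \<in> int_space (beta_dual X)"
    using a by (simp add: int_space_def beta_dual_def omega_def)
next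
  fix a assume a: "a \<in> int_space (beta_dual X)"
  have "(\<lambda>k. a k * x k) \<in> cs" if x: "x \<in> diff_space X" for x
  proof -
    have "(\<lambda>k. of_nat k * a k * (inverse (of_nat k) * x k)) \<in> cs"
      using a x by (simp add: int_space_def beta_dual_def diff_space_def)
    \<comment> \<open>The weights cancel for k > 0; at k = 0 the left side is 0, and so is the right
      because x lies in \<open>omega\<close>.\<close>
    moreover have "of_nat k * a k * (inverse (of_nat k) * x k) = a k * x k" for k
      using x by (cases "k = 0") (auto simp: diff_space_def omega_def)
    ultimately show ?thesis
      by simp
  qed
  then show "a \<in> beta_dual (diff_space X)"
    using a by (simp add: int_space_def beta_dual_def)
qed

theorem theorem3p8:
  assumes "beta_dual bv = cs"
  shows "beta_dual (diff_space bv) = int_space cs"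
proof -
  have "bv \<subseteq> omega"
    by (auto simp: bv_def)
  then show ?thesis
    using assms by (simp add: beta_dual_diff_space)
qed

end
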